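(* The set $$\mathcal{P}_{\mathrm{sl}}=\bigl\{(A,B)\in\mathcal{C}\times\mathcal{C} : A\le_{\mathrm{sl}} B \text{ or } B\le_{\mathrm{sl}} A\bigr\}$$ is closed and nowhere dense in $(\mathcal{C}\times\mathcal{C},d\times d)$.
   Context: A (bivariate) copula is a function $C:[0,1]^2\to[0,1]$ such that $C(t,0)=C(0,t)=0$ and $C(t,1)=C(1,t)=t$ for all $t\in[0,1]$, and $C(u',v')-C(u,v')-C(u',v)+C(u,v)\ge 0$ whenever $u\le u'$, $v\le v'$ in $[0,1]$. Equivalently, $C$ is the restriction to $[0,1]^2$ of the distribution function of a Borel probability measure on $[0,1]^2$ with both marginals uniform on $[0,1]$; $(X,Y)\sim C$ means that the random vector $(X,Y)$ has this law. $\mathcal{C}$ is the set of all copulas, with the uniform metric $d(A,B)=\sup_{(x,y)\in[0,1]^2}|A(x,y)-B(x,y)|$. The product $\mathcal{C}\times\mathcal{C}$ carries the metric $(d\times d)((A,B),(A',B'))=\max\{d(A,A'),d(B,B')\}$. For $A,B\in\mathcal{C}$, $A\le_{\mathrm{sl}}B$ (stop-loss order on sums) means $\mathbb{E}[(S_A-t)^+]\le\mathbb{E}[(S_B-t)^+]$ for every $t\in\mathbb{R}$, where $S_A=X+Y$ with $(X,Y)\sim A$, $S_B=X'+Y'$ with $(X',Y')\sim B$, and $z^+=\max(z,0)$. A set is nowhere dense if its closure has empty interior. *)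

theory Defs
  imports "HOL-Probability.Probability"
begin

abbreviation unit_square :: "(real \<times> real) set" where
  "unit_square \<equiv> {0..1} \<times> {0..1}"

text \<open>
  A copula is a function on the unit square only. Members of \<open>copulas\<close> are therefore extensional
  (set to \<open>undefined\<close> off the square), so that equality of copulas is equality on the
  square and \<open>copula_dist\<close> separates points.
\<close>

definition copulas :: "(real \<times> real \<Rightarrow> real) set" where
  "copulas = {C \<in> unit_square \<rightarrow>\<^sub>E {0..1}.
     (\<forall>t\<in>{0..1}. C (t, 0) = 0 \<and> C (0, t) = 0) \<and>
     (\<forall>t\<in>{0..1}. C (t, 1) = t \<and> C (1, t) = t) \<and>
     (\<forall>u\<in>{0..1}. \<forall>u'\<in>{0..1}. \<forall>v\<in>{0..1}. \<forall>v'\<in>{0..1}. u \<le> u' \<longrightarrow> v \<le> v' \<longrightarrow>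
        C (u', v') - C (u, v') - C (u', v) + C (u, v) \<ge> 0)}"

text \<open>
  The value 0 off \<open>copulas\<close> is irrelevant; \<open>Metric_space\<close> requires
  nonnegativity and symmetry of the distance on the whole type.
\<close>

definition copula_dist :: "(real \<times> real \<Rightarrow> real) \<Rightarrow> (real \<times> real \<Rightarrow> real) \<Rightarrow> real" where
  "copula_dist A B = (if A \<in> copulas \<and> B \<in> copulas
     then (SUP p\<in>unit_square. \<bar>A p - B p\<bar>) else 0)"

text \<open>
  The library's \<open>prod_dist\<close> is the Euclidean product; this is the maximum product.
\<close>

definition max_dist :: "('a \<Rightarrow> 'a \<Rightarrow> real) \<Rightarrow> ('b \<Rightarrow> 'b \<Rightarrow> real) \<Rightarrow> 'a \<times> 'b \<Rightarrow> 'a \<times> 'b \<Rightarrow> real" where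
  "max_dist d1 d2 = (\<lambda>(x, y) (x', y'). max (d1 x x') (d2 y y'))"

definition is_copula_law :: "(real \<times> real \<Rightarrow> real) \<Rightarrow> (real \<times> real) measure \<Rightarrow> bool" where
  "is_copula_law C M \<longleftrightarrow>
     prob_space M \<and> sets M = sets borel \<and>
     (AE p in M. p \<in> unit_square) \<and>
     distr M borel fst = uniform_measure lborel {0..1} \<and>
     distr M borel snd = uniform_measure lborel {0..1} \<and>
     (\<forall>x\<in>{0..1}. \<forall>y\<in>{0..1}. measure M ({..x} \<times> {..y}) = C (x, y))"

text \<open>
  For \<open>C \<in> copulas\<close> exactly one Borel measure satisfies \<open>is_copula_law C\<close>. The random
  vector \<open>(X, Y)\<close> with law \<open>C\<close> is realised as the identity on this canonical space.
\<close>

definition copula_law :: "(real \<times> real \<Rightarrow> real) \<Rightarrow> (real \<times> real) measure" where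
  "copula_law C = (THE M. is_copula_law C M)"

definition stop_loss :: "(real \<times> real \<Rightarrow> real) \<Rightarrow> real \<Rightarrow> real" where
  "stop_loss C t = (\<integral>(x, y). max (x + y - t) 0 \<partial>copula_law C)"

definition sl_le :: "(real \<times> real \<Rightarrow> real) \<Rightarrow> (real \<times> real \<Rightarrow> real) \<Rightarrow> bool"
    (infix \<open>\<le>\<^sub>s\<^sub>l\<close> 50) where
  "A \<le>\<^sub>s\<^sub>l B \<longleftrightarrow> (\<forall>t. stop_loss A t \<le> stop_loss B t)"

definition P_sl :: "((real \<times> real \<Rightarrow> real) \<times> (real \<times> real \<Rightarrow> real)) set" where
  "P_sl = {(A, B) \<in> copulas \<times> copulas. A \<le>\<^sub>s\<^sub>l B \<or> B \<le>\<^sub>s\<^sub>l A}"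

definition nowhere_dense_in :: "'a topology \<Rightarrow> 'a set \<Rightarrow> bool" where
  "nowhere_dense_in T S \<longleftrightarrow> S \<subseteq> topspace T \<and> T interior_of (T closure_of S) = {}"

text \<open>
  \<open>Metric_space.mtopology\<close> is only meaningful on a metric space, hence the next two lemmas.
\<close>

lemma Metric_space_copulas: "Metric_space copulas copula_dist"
proof
  have PiE: "C \<in> unit_square \<rightarrow>\<^sub>E {0..1}" if "C \<in> copulas" for C
    using that unfolding copulas_def mem_Collect_eq by (rule conjunct1)
  have bdd: "bdd_above ((\<lambda>p. \<bar>A p - B p\<bar>) ` unit_square)"
    if "A \<in> copulas" "B \<in> copulas" for A B :: "real \<times> real \<Rightarrow> real"
  proof (rule bdd_aboveI2)
    fix p :: "real \<times> real" assume "p \<in> unit_square"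
    then have "A p \<in> {0..1}" "B p \<in> {0..1}"
      using PiE_mem[OF PiE] that by blast+
    then show "\<bar>A p - B p\<bar> \<le> 1" unfolding atLeastAtMost_iff by linarith
  qed
  have upper: "\<bar>A p - B p\<bar> \<le> copula_dist A B"
    if "A \<in> copulas" "B \<in> copulas" "p \<in> unit_square" for A B p
    using cSUP_upper[OF that(3) bdd[OF that(1,2)]] that by (simp add: copula_dist_def)
  show nn: "0 \<le> copula_dist A B" for A B
  proof (cases "A \<in> copulas \<and> B \<in> copulas")
    case True
    then have "\<bar>A (0, 0) - B (0, 0)\<bar> \<le> copula_dist A B"
      by (intro upper) simp_all
    then show ?thesis by linarith
  qed (simp only: copula_dist_def if_False order_refl)
  show "copula_dist A B = copula_dist B A" for A B
    unfolding copula_dist_def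
    by (subst abs_minus_commute, subst conj_commute) (rule refl)
  show "copula_dist A B = 0 \<longleftrightarrow> A = B" if AB: "A \<in> copulas" "B \<in> copulas" for A B
  proof
    assume "copula_dist A B = 0"
    then have "A p = B p" if "p \<in> unit_square" for p
      using upper[OF AB that] by simp
    moreover have "A \<in> extensional unit_square" "B \<in> extensional unit_square"
      using AB PiE unfolding PiE_def by blast+
    ultimately show "A = B" by (intro extensionalityI)
  qed (use AB in \<open>simp add: copula_dist_def\<close>)
  show "copula_dist A C \<le> copula_dist A B + copula_dist B C"
    if ABC: "A \<in> copulas" "B \<in> copulas" "C \<in> copulas" for A B C
  proof -
    have "(SUP p\<in>unit_square. \<bar>A p - C p\<bar>) \<le> copula_dist A B + copula_dist B C"
    proof (rule cSUP_least)
      fix p :: "real \<times> real" assume p: "p \<in> unit_square"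
      show "\<bar>A p - C p\<bar> \<le> copula_dist A B + copula_dist B C"
        using upper[OF ABC(1,2) p] upper[OF ABC(2,3) p] by linarith
    qed simp
    then show ?thesis using ABC by (simp add: copula_dist_def)
  qed
qed

lemma Metric_space_max_dist:
  assumes "Metric_space M1 d1" "Metric_space M2 d2"
  shows "Metric_space (M1 \<times> M2) (max_dist d1 d2)"
proof -
  interpret A: Metric_space M1 d1 by fact
  interpret B: Metric_space M2 d2 by fact
  show ?thesis
  proof
    fix x y z
    show "0 \<le> max_dist d1 d2 x y"
      by (simp add: max_dist_def le_max_iff_disj split: prod.split)
    show "max_dist d1 d2 x y = max_dist d1 d2 y x"
      by (auto simp: max_dist_def A.commute B.commute split: prod.split)
    assume xy: "x \<in> M1 \<times> M2" "y \<in> M1 \<times> M2"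
    show "max_dist d1 d2 x y = 0 \<longleftrightarrow> x = y"
    proof -
      obtain a b a' b' where eq: "x = (a, b)" "y = (a', b')"
        by (cases x, cases y)
      have "max (d1 a a') (d2 b b') = 0 \<longleftrightarrow> d1 a a' = 0 \<and> d2 b b' = 0"
        using A.nonneg[of a a'] B.nonneg[of b b'] by linarith
      then show ?thesis using xy eq by (simp add: max_dist_def)
    qed
    assume z: "z \<in> M1 \<times> M2"
    show "max_dist d1 d2 x z \<le> max_dist d1 d2 x y + max_dist d1 d2 y z"
    proof -
      obtain a b a' b' a'' b'' where eq: "x = (a, b)" "y = (a', b')" "z = (a'', b'')"
        by (cases x, cases y, cases z)
      have "d1 a a'' \<le> d1 a a' + d1 a' a''" "d2 b b'' \<le> d2 b b' + d2 b' b''"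
        using xy z eq by (auto intro: A.triangle B.triangle)
      then have "max (d1 a a'') (d2 b b'') \<le> max (d1 a a') (d2 b b') + max (d1 a' a'') (d2 b' b'')"
        by linarith
      then show ?thesis by (simp only: eq max_dist_def prod.case)
    qed
  qed
qed

end

theory Submission
  imports Defs
begin

text \<open>
  Writing \<open>(x + y - t)\<^sup>+\<close> as the length of \<open>{t - y<..<x}\<close> and exchanging integrals shows that
  \<open>stop_loss A t - stop_loss B t\<close> is the integral of \<open>A - B\<close> along the line \<open>x + y = t\<close>. Hence
  \<open>stop_loss\<close> is 1-Lipschitz in the copula, so incomparability is an open condition. It is also dense:
  compressing \<open>A\<close> and \<open>B\<close> into \<open>[a, 1]\<^sup>2\<close> moves them by \<open>O(a)\<close> and leaves the square \<open>[0, a]\<^sup>2\<close>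
  free. There one puts comonotone mass followed by countermonotone mass for \<open>A\<close>, and the two in the
  opposite order for \<open>B\<close>. The stop-loss transforms then compare strictly in opposite directions at
  \<open>t = a / 2\<close> and \<open>t = 3 a / 2\<close>.

  A law with distribution function \<open>C\<close> is obtained by disintegration: for each \<open>q\<close> the function
  \<open>u \<mapsto> C (u, q)\<close> is the distribution function of a measure with a density \<open>h q \<le> 1\<close>, almost
  everywhere increasing in rational \<open>q\<close>; if \<open>X\<close> and \<open>V\<close> are independent and uniform, the second
  coordinate is the infimum of the rational \<open>q\<close> with \<open>V \<le> h q X\<close>.
\<close>

section \<open>Copulas extended to the plane\<close>

definition clip :: "real \<Rightarrow> real" where
  "clip x = min 1 (max 0 x)"

text \<open>Composition with the projection of the plane onto the unit square. For a copula this is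
  the joint distribution function on the whole plane, so whole lines \<open>x + y = t\<close> can be
  integrated over and the value \<open>undefined\<close> is never met.\<close>

definition cext :: "(real \<times> real \<Rightarrow> real) \<Rightarrow> real \<Rightarrow> real \<Rightarrow> real" where
  "cext C x y = C (clip x, clip y)"

lemma clip_mem [simp]: "clip x \<in> {0..1}"
  by (simp add: clip_def)

lemma clip_bounds [simp]: "0 \<le> clip x" "clip x \<le> 1"
  by (simp_all add: clip_def)

lemma clip_id: "x \<in> {0..1} \<Longrightarrow> clip x = x"
  by (simp add: clip_def)

lemma clip_clip [simp]: "clip (clip x) = clip x"
  by (simp add: clip_def)

lemma clip_nonpos: "x \<le> 0 \<Longrightarrow> clip x = 0"
  by (simp add: clip_def)

lemma clip_ge_one: "1 \<le> x \<Longrightarrow> clip x = 1"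
  by (simp add: clip_def)

lemma clip_mono: "x \<le> y \<Longrightarrow> clip x \<le> clip y"
  by (simp add: clip_def min_def max_def)

lemma clip_lipschitz: "\<bar>clip x - clip y\<bar> \<le> \<bar>x - y\<bar>"
  by (simp add: clip_def min_def max_def)

text \<open>With the next lemma, this lets the formula of an ordinal sum hold off the square too:
  clipping before rescaling loses nothing, since whatever the first clip alters is sent to the same
  end of [0, 1] by the second.\<close>

lemma clip_divide_clip:
  assumes "0 < a" "a \<le> 1"
  shows "clip (clip x / a) = clip (x / a)"
proof -
  consider "x \<le> 0" | "0 < x" "x < 1" | "1 \<le> x" by linarith
  then show ?thesis
  proof cases
    case 3
    then have "clip (x / a) = 1" "clip (1 / a) = 1"
      using assms by (auto intro!: clip_ge_one simp: field_simps)
    with 3 show ?thesis by (simp add: clip_ge_one)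
  qed (use assms in \<open>auto simp: clip_nonpos clip_id divide_le_0_iff\<close>)
qed

lemma clip_rescale_clip:
  assumes "0 \<le> a" "a < 1"
  shows "clip ((clip x - a) / (1 - a)) = clip ((x - a) / (1 - a))"
proof -
  consider "x \<le> 0" | "0 < x" "x < 1" | "1 \<le> x" by linarith
  then show ?thesis
  proof cases
    case 1
    then have "clip ((x - a) / (1 - a)) = 0" "clip ((0 - a) / (1 - a)) = 0"
      using assms by (auto intro!: clip_nonpos simp: divide_le_0_iff)
    with 1 show ?thesis by (simp add: clip_nonpos)
  next
    case 3
    then have "clip ((x - a) / (1 - a)) = 1" "clip ((1 - a) / (1 - a)) = 1"
      using assms by (auto intro!: clip_ge_one simp: field_simps)
    with 3 show ?thesis by (simp add: clip_ge_one)
  qed (simp add: clip_id)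
qed

text \<open>The range condition comes from the rectangle inequality on
  \<open>[0, x] \<times> [0, y]\<close>, giving nonnegativity, and on
  \<open>[x, 1] \<times> [0, y]\<close>, giving the upper bound \<open>y\<close>.\<close>

lemma copulasI:
  assumes "C \<in> extensional unit_square"
    and "\<And>t. t \<in> {0..1} \<Longrightarrow> C (t, 0) = 0" "\<And>t. t \<in> {0..1} \<Longrightarrow> C (0, t) = 0"
    and "\<And>t. t \<in> {0..1} \<Longrightarrow> C (t, 1) = t" "\<And>t. t \<in> {0..1} \<Longrightarrow> C (1, t) = t"
    and incr: "\<And>u u' v v'. \<lbrakk>u \<in> {0..1}; u' \<in> {0..1}; v \<in> {0..1}; v' \<in> {0..1}; u \<le> u'; v \<le> v'\<rbrakk>
      \<Longrightarrow> C (u', v') - C (u, v') - C (u', v) + C (u, v) \<ge> 0"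
  shows "C \<in> copulas"
proof -
  have "C (x, y) \<in> {0..1}" if "x \<in> {0..1}" "y \<in> {0..1}" for x y
    using incr[of 0 x 0 y] incr[of x 1 0 y] assms(2-5) that by auto
  then have "C \<in> unit_square \<rightarrow>\<^sub>E {0..1}"
    using assms(1) by (auto simp: PiE_def)
  then show ?thesis
    using assms(2-) unfolding copulas_def by (intro CollectI conjI ballI impI) auto
qed

context
  fixes C :: "real \<times> real \<Rightarrow> real"
  assumes C: "C \<in> copulas"
begin

lemma copula_zero [simp]: "t \<in> {0..1} \<Longrightarrow> C (t, 0) = 0" "t \<in> {0..1} \<Longrightarrow> C (0, t) = 0"
  and copula_one [simp]: "t \<in> {0..1} \<Longrightarrow> C (t, 1) = t" "t \<in> {0..1} \<Longrightarrow> C (1, t) = t"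
  using C unfolding copulas_def by blast+

lemma copula_rect:
  "\<lbrakk>u \<in> {0..1}; u' \<in> {0..1}; v \<in> {0..1}; v' \<in> {0..1}; u \<le> u'; v \<le> v'\<rbrakk>
    \<Longrightarrow> C (u', v') - C (u, v') - C (u', v) + C (u, v) \<ge> 0"
  using C unfolding copulas_def by blast

lemma cext_rect:
  assumes "u \<le> u'" "v \<le> v'"
  shows "cext C u' v' - cext C u v' - cext C u' v + cext C u v \<ge> 0"
  unfolding cext_def using assms by (intro copula_rect) (auto intro: clip_mono)

lemma cext_nonpos: "x \<le> 0 \<or> y \<le> 0 \<Longrightarrow> cext C x y = 0"
  by (auto simp: cext_def clip_nonpos)

lemma cext_ge_one: "1 \<le> x \<Longrightarrow> cext C x y = clip y" "1 \<le> y \<Longrightarrow> cext C x y = clip x"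
  by (auto simp: cext_def clip_ge_one)

text \<open>The rectangle inequality with one edge pushed to a coordinate \<open><= 0\<close>, where
  \<open>cext C\<close> vanishes.\<close>

lemma cext_mono:
  assumes "x \<le> x'" "y \<le> y'"
  shows "cext C x y \<le> cext C x' y'"
proof -
  have "cext C x y \<le> cext C x' y"
    using cext_rect[of x x' "min y 0" y] assms by (simp add: cext_nonpos)
  also have "\<dots> \<le> cext C x' y'"
    using cext_rect[of "min x' 0" x' y y'] assms by (simp add: cext_nonpos)
  finally show ?thesis .
qed

lemma cext_nonneg: "0 \<le> cext C x y"
  using cext_mono[of "min x 0" x y y] by (simp add: cext_nonpos)

lemma cext_le: "cext C x y \<le> clip x" "cext C x y \<le> clip y"
  using cext_mono[of x x y "max y 1"] cext_mono[of x "max x 1" y y] by (simp_all add: cext_ge_one)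

text \<open>The rectangle inequality with one edge at or beyond 1, where \<open>cext C\<close>
  reduces to its margin \<open>clip\<close>; hence no increment exceeds that of the margin.\<close>

lemma cext_increment_le:
  assumes "x \<le> x'"
  shows "cext C x' y - cext C x y \<le> clip x' - clip x" "cext C y x' - cext C y x \<le> clip x' - clip x"
  using cext_rect[of x x' y "max y 1"] cext_rect[of y "max y 1" x x'] assms
  by (simp_all add: cext_ge_one)

lemma cext_lipschitz: "\<bar>cext C x y - cext C x' y'\<bar> \<le> \<bar>x - x'\<bar> + \<bar>y - y'\<bar>"
proof -
  have 1: "\<bar>cext C x y - cext C x' y\<bar> \<le> \<bar>x - x'\<bar>" for x x' y
    using cext_increment_le(1)[of x x' y] cext_increment_le(1)[of x' x y]
      cext_mono[of x x' y y] cext_mono[of x' x y y] clip_lipschitz[of x x']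
    by linarith
  have 2: "\<bar>cext C x y - cext C x y'\<bar> \<le> \<bar>y - y'\<bar>" for x y y'
    using cext_increment_le(2)[of y y' x] cext_increment_le(2)[of y' y x]
      cext_mono[of x x y y'] cext_mono[of x x y' y] clip_lipschitz[of y y']
    by linarith
  show ?thesis using 1[of x y x'] 2[of x' y y'] by linarith
qed

lemma continuous_on_cext:
  assumes "continuous_on S f" "continuous_on S g"
  shows "continuous_on S (\<lambda>s. cext C (f s) (g s))"
proof -
  have "continuous_on UNIV (\<lambda>p. cext C (fst p) (snd p))"
  proof (rule lipschitz_on_continuous_on, rule lipschitz_onI)
    fix p q :: "real \<times> real"
    have "\<bar>fst p - fst q\<bar> \<le> dist p q" "\<bar>snd p - snd q\<bar> \<le> dist p q"
      using dist_fst_le[of p q] dist_snd_le[of p q] by (simp_all add: dist_real_def)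
    then show "dist (cext C (fst p) (snd p)) (cext C (fst q) (snd q)) \<le> 2 * dist p q"
      using cext_lipschitz[of "fst p" "snd p" "fst q" "snd q"] by (simp add: dist_real_def)
  qed simp
  then have "continuous_on S ((\<lambda>p. cext C (fst p) (snd p)) \<circ> (\<lambda>s. (f s, g s)))"
    by (intro continuous_on_compose continuous_on_Pair assms) (auto elim: continuous_on_subset)
  then show ?thesis by (simp add: comp_def)
qed

end

section \<open>The law of a copula\<close>

text \<open>Dynkin's argument on the half-lines, run on the additive identity itself instead of on a
  sum measure. The total masses serve for complements, where finiteness of \<open>N\<close> permits
  cancelling \<open>emeasure N A\<close>.\<close>

lemma finite_borel_measures_add:
  fixes L M N :: "real measure"
  assumes "finite_measure L" "finite_measure M" "finite_measure N"
    and sets: "sets L = sets borel" "sets M = sets borel" "sets N = sets borel"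
    and atMost: "\<And>x. emeasure L {..x} + emeasure M {..x} = emeasure N {..x}"
    and UNIV: "emeasure L UNIV + emeasure M UNIV = emeasure N UNIV"
    and A: "A \<in> sets borel"
  shows "emeasure L A + emeasure M A = emeasure N A"
proof -
  interpret L: finite_measure L by fact
  interpret M: finite_measure M by fact
  interpret N: finite_measure N by fact
  have space: "space L = UNIV" "space M = UNIV" "space N = UNIV"
    using sets[THEN sets_eq_imp_space_eq] by simp_all
  have borel: "sets borel = sigma_sets UNIV (range (\<lambda>a::real. {..a}))"
    by (simp add: borel_eq_atMost)
  have "Int_stable (range (\<lambda>a::real. {..a}))"
    by (auto simp: Int_stable_def min_def intro!: exI)
  moreover have "range (\<lambda>a::real. {..a}) \<subseteq> Pow UNIV" by simp
  moreover note A[unfolded borel]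
  ultimately show ?thesis
  proof (induction rule: sigma_sets_induct_disjoint)
    case (basic A) then show ?case using atMost by auto
  next
    case (compl A)
    then have A: "A \<in> sets borel" by (simp add: borel)
    have split: "emeasure K UNIV = emeasure K A + emeasure K (UNIV - A)" if "sets K = sets borel" for K
    proof -
      have "UNIV - A \<in> sets K" using sets.compl_sets[OF A] that by simp
      then have "emeasure K A + emeasure K (UNIV - A) = emeasure K (A \<union> (UNIV - A))"
        using A that by (intro plus_emeasure) auto
      then show ?thesis by simp
    qed
    have "emeasure N A + (emeasure L (UNIV - A) + emeasure M (UNIV - A))
        = emeasure N A + emeasure N (UNIV - A)"
      using UNIV unfolding split[OF sets(1)] split[OF sets(2)] split[OF sets(3)] compl.IH[symmetric]
      by (simp add: ac_simps)
    then show ?case by simp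
  next
    case (union A)
    then have A: "range A \<subseteq> sets L" "range A \<subseteq> sets M" "range A \<subseteq> sets N"
      by (simp_all add: sets borel)
    show ?case
      using union suminf_emeasure[OF A(1)] suminf_emeasure[OF A(2)] suminf_emeasure[OF A(3)]
        suminf_add[of "\<lambda>i. emeasure L (A i)" "\<lambda>i. emeasure M (A i)"]
      by simp
  qed simp_all
qed

text \<open>On the set where \<open>g < f\<close>, the finite integral of \<open>g\<close> can be
  cancelled, so the nonnegative excess \<open>f - g\<close> integrates to 0 there.\<close>

lemma density_le_imp_AE_le:
  assumes "finite_measure N" and [measurable]: "f \<in> borel_measurable N" "g \<in> borel_measurable N"
    and bounds: "\<And>x. 0 \<le> f x" "\<And>x. f x \<le> 1" "\<And>x. 0 \<le> g x" "\<And>x. g x \<le> (1::real)"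
    and le: "\<And>A. A \<in> sets N \<Longrightarrow> (\<integral>\<^sup>+x\<in>A. ennreal (f x) \<partial>N) \<le> (\<integral>\<^sup>+x\<in>A. ennreal (g x) \<partial>N)"
  shows "AE x in N. f x \<le> g x"
proof -
  interpret finite_measure N by fact
  define A where "A = {x \<in> space N. g x < f x}"
  have [measurable]: "A \<in> sets N" unfolding A_def by measurable
  have "(\<integral>\<^sup>+x\<in>A. ennreal (f x) \<partial>N) = (\<integral>\<^sup>+x\<in>A. ennreal (g x) \<partial>N) + (\<integral>\<^sup>+x\<in>A. ennreal (f x - g x) \<partial>N)"
    using bounds by (subst nn_integral_add[symmetric])
      (auto intro!: nn_integral_cong simp: A_def indicator_def ennreal_plus[symmetric] simp del: ennreal_plus)
  moreover have "(\<integral>\<^sup>+x\<in>A. ennreal (g x) \<partial>N) \<le> (\<integral>\<^sup>+x. 1 \<partial>N)"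
    using bounds by (intro nn_integral_mono) (auto simp: indicator_def)
  then have "(\<integral>\<^sup>+x\<in>A. ennreal (g x) \<partial>N) \<noteq> \<infinity>"
    using emeasure_finite by (auto simp: top_unique)
  ultimately have "(\<integral>\<^sup>+x\<in>A. ennreal (f x - g x) \<partial>N) = 0"
    using le[of A] ennreal_add_left_cancel_le[of "\<integral>\<^sup>+x\<in>A. ennreal (g x) \<partial>N" _ 0] by auto
  then have "AE x in N. ennreal (f x - g x) * indicator A x = 0"
    by (subst (asm) nn_integral_0_iff_AE) auto
  then show ?thesis
    by (rule AE_mp) (auto simp: A_def indicator_def ennreal_eq_0_iff not_less split: if_splits)
qed

text \<open>A Radon-Nikodym density cannot exceed 1 on a set of positive measure, because its excess
  over 1 would violate the domination of \<open>M\<close> by \<open>N\<close>.\<close>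

lemma exists_density_le_one:
  assumes "finite_measure N" "finite_measure M" and sets: "sets M = sets N"
    and le: "\<And>A. A \<in> sets N \<Longrightarrow> emeasure M A \<le> emeasure N A"
  obtains h :: "'a \<Rightarrow> real" where "h \<in> borel_measurable N" "\<And>x. 0 \<le> h x" "\<And>x. h x \<le> 1"
    "\<And>A. A \<in> sets N \<Longrightarrow> emeasure M A = (\<integral>\<^sup>+x\<in>A. ennreal (h x) \<partial>N)"
proof -
  interpret N: finite_measure N by fact
  interpret M: finite_measure M by fact
  have "absolutely_continuous N M"
    unfolding absolutely_continuous_def using le sets
    by (auto simp: null_sets_def) (metis le_zero_eq)
  from N.Radon_Nikodym_finite_measure[OF \<open>finite_measure M\<close> sets this]
  obtain f where f [measurable]: "f \<in> borel_measurable N" and "density N f = M"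
    by blast
  then have M: "emeasure M A = (\<integral>\<^sup>+x\<in>A. f x \<partial>N)" if "A \<in> sets N" for A
    using that by (metis emeasure_density)
  have "AE x in N. f x \<le> 1"
  proof -
    define A where "A = {x \<in> space N. 1 < f x}"
    have [measurable]: "A \<in> sets N" unfolding A_def by measurable
    have "(\<integral>\<^sup>+x\<in>A. f x \<partial>N) = (\<integral>\<^sup>+x. indicator A x \<partial>N) + (\<integral>\<^sup>+x\<in>A. (f x - 1) \<partial>N)"
      by (subst nn_integral_add[symmetric])
        (auto intro!: nn_integral_cong simp: A_def indicator_def add_diff_inverse_ennreal less_imp_le)
    then have "emeasure N A + (\<integral>\<^sup>+x\<in>A. (f x - 1) \<partial>N) \<le> emeasure N A + 0"
      using le[of A] M[of A] by simp
    then have "(\<integral>\<^sup>+x\<in>A. (f x - 1) \<partial>N) = 0"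
      unfolding ennreal_add_left_cancel_le using N.emeasure_finite[of A] by auto
    then have "AE x in N. (f x - 1) * indicator A x = 0"
      by (subst (asm) nn_integral_0_iff_AE) auto
    then show ?thesis
    proof (rule AE_mp, intro AE_I2 impI)
      fix x assume "x \<in> space N" "(f x - 1) * indicator A x = 0"
      then show "f x \<le> 1"
        by (cases "f x \<le> 1") (auto simp: A_def indicator_def diff_eq_0_iff_ennreal not_le split: if_splits)
    qed
  qed
  \<comment> \<open>Truncation at 1 changes the density on a null set only and makes the bounds
    valid at every point.\<close>
  then have "AE x in N. f x = ennreal (enn2real (min 1 (f x)))"
    by (rule AE_mp, intro AE_I2) (auto simp: min_def intro!: ennreal_enn2real[symmetric] elim: le_less_trans)
  then have "emeasure M A = (\<integral>\<^sup>+x\<in>A. ennreal (enn2real (min 1 (f x))) \<partial>N)" if "A \<in> sets N" for A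
    unfolding M[OF that] by (intro nn_integral_cong_AE) auto
  then show ?thesis
    by (intro that[of "\<lambda>x. enn2real (min 1 (f x))"]) (auto simp: enn2real_leI)
qed

abbreviation unif :: "real measure" where
  "unif \<equiv> uniform_measure lborel {0..1}"

lemma prob_space_unif: "prob_space unif"
  by (rule prob_space_uniform_measure) auto

lemma emeasure_unif_atMost: "emeasure unif {..x} = ennreal (clip x)"
proof -
  have "{0..1} \<inter> {..x} = {0..clip x}" if "0 \<le> x" using that by (auto simp: clip_def)
  moreover have "{0..1} \<inter> {..x} = {}" if "x < 0" using that by auto
  ultimately show ?thesis
    by (cases "0 \<le> x") (auto simp: clip_nonpos divide_ennreal_def)
qed

text \<open>The given values at 0 and 1 are 0 and 1, and monotonicity propagates them to the
  half-lines on either side, so the whole distribution function is known.\<close>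

lemma eq_unif:
  assumes "prob_space M" "sets M = sets borel"
    and cdf: "\<And>x. x \<in> {0..1} \<Longrightarrow> measure M {..x} = x"
  shows "M = unif"
proof (rule cdf_unique)
  interpret prob_space M by fact
  interpret U: prob_space unif by (rule prob_space_unif)
  show "real_distribution M"
    using assms(2) by (intro real_distribution.intro assms(1)) (simp add: real_distribution_axioms_def)
  show "real_distribution unif"
    by (intro real_distribution.intro prob_space_unif) (simp add: real_distribution_axioms_def)
  show "cdf M = cdf unif"
  proof
    fix x
    have "measure M {..x} = clip x"
    proof -
      consider "x \<le> 0" | "x \<in> {0..1}" | "1 \<le> x" by fastforce
      then show ?thesis
      proof cases
        case 1
        then have "measure M {..x} \<le> measure M {..0}"
          by (intro finite_measure_mono) (auto simp: assms(2))
        then show ?thesis using cdf[of 0] 1 measure_nonneg[of M "{..x}"] clip_nonpos[OF 1] by simp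
      next
        case 3
        then have "measure M {..1} \<le> measure M {..x}"
          by (intro finite_measure_mono) (auto simp: assms(2))
        then show ?thesis using cdf[of 1] 3 prob_le_1[of "{..x}"] clip_ge_one[OF 3] by simp
      qed (auto simp: cdf clip_id)
    qed
    also have "\<dots> = measure unif {..x}"
      using emeasure_unif_atMost[of x] U.emeasure_eq_measure by simp
    finally show "cdf M x = cdf unif x" by (simp add: cdf_def)
  qed
qed

text \<open>Stieltjes measures in the form shared by slices of a copula and differences of slices:
  \<open>F\<close> is constant on each side of [0, 1], so its limits at infinity are attained and
  \<open>m\<close> is the total mass.\<close>

lemma interval_measure_unit:
  fixes F :: "real \<Rightarrow> real"
  assumes mono: "\<And>x y. x \<le> y \<Longrightarrow> F x \<le> F y" and cont: "continuous_on UNIV F"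
    and low: "\<And>x. x \<le> 0 \<Longrightarrow> F x = 0" and high: "\<And>x. 1 \<le> x \<Longrightarrow> F x = m"
  shows "emeasure (interval_measure F) {..x} = F x"
    and "emeasure (interval_measure F) UNIV = m"
    and "finite_measure (interval_measure F)"
proof -
  have rc: "continuous (at_right a) F" for a
    using cont by (auto intro: continuous_at_imp_continuous_at_within simp: continuous_on_eq_continuous_at)
  have bot: "(F \<longlongrightarrow> 0) at_bot"
    by (rule tendsto_eventually) (use low eventually_at_bot_linorder in blast)
  have top: "(F \<longlongrightarrow> m) at_top"
    by (rule tendsto_eventually) (use high eventually_at_top_linorder in blast)
  have m: "0 \<le> m" using mono[of 0 1] low[of 0] high[of 1] by simp
  show "emeasure (interval_measure F) {..x} = F x"
    by (rule emeasure_interval_measure_Iic[OF mono rc bot])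
  show "emeasure (interval_measure F) UNIV = m"
    by (rule interval_measure_UNIV[OF mono rc bot top m])
  show "finite_measure (interval_measure F)"
    by (rule finite_borel_measure.axioms(1), rule finite_borel_measure_interval_measure[OF mono rc bot top m])
qed

section \<open>Disintegration of a copula over its first coordinate\<close>

context
  fixes C :: "real \<times> real \<Rightarrow> real"
  assumes C: "C \<in> copulas"
begin

text \<open>For (X, Y) with law \<open>C\<close> this is the measure sending \<open>A\<close> to the
  probability of X in \<open>A\<close> and Y \<open><= q\<close>, written down before such a law is
  known to exist.\<close>

definition slice :: "real \<Rightarrow> real measure" where
  "slice q = interval_measure (\<lambda>u. cext C u q)"

lemma
  shows emeasure_slice_atMost: "emeasure (slice q) {..x} = cext C x q"
    and emeasure_slice_UNIV: "emeasure (slice q) UNIV = clip q"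
    and finite_measure_slice: "finite_measure (slice q)"
  unfolding slice_def
  by (rule interval_measure_unit;
      auto intro: cext_mono[OF C] continuous_on_cext[OF C] simp: cext_nonpos[OF C] cext_ge_one[OF C])+

lemma sets_slice [simp]: "sets (slice q) = sets borel"
  by (simp add: slice_def)

lemma slice_one: "slice 1 = unif"
  by (rule eq_unif) (auto simp: measure_def emeasure_slice_atMost cext_ge_one[OF C] clip_id
      emeasure_slice_UNIV sets_eq_imp_space_eq[OF sets_slice] intro!: prob_spaceI)

text \<open>The rectangle inequality makes the difference of the two distribution functions
  increasing. It is therefore the distribution function of a measure, and adding this measure to
  \<open>slice q\<close> yields \<open>slice q'\<close>.\<close>

lemma slice_mono:
  assumes "q \<le> q'" and A: "A \<in> sets borel"
  shows "emeasure (slice q) A \<le> emeasure (slice q') A"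
proof -
  let ?F = "\<lambda>u. cext C u q' - cext C u q"
  have mono: "?F u \<le> ?F u'" if "u \<le> u'" for u u'
    using cext_rect[OF C that assms(1)] by simp
  have cont: "continuous_on UNIV ?F"
    by (intro continuous_intros continuous_on_cext[OF C])
  have low: "?F u = 0" if "u \<le> 0" for u
    using that by (simp add: cext_nonpos[OF C])
  have high: "?F u = clip q' - clip q" if "1 \<le> u" for u
    using that by (simp add: cext_ge_one[OF C])
  note K = interval_measure_unit[OF mono cont low high]
  have "emeasure (slice q) A + emeasure (interval_measure ?F) A = emeasure (slice q') A"
  proof (rule finite_borel_measures_add[OF finite_measure_slice K(3) finite_measure_slice])
    show "emeasure (slice q) {..x} + emeasure (interval_measure ?F) {..x} = emeasure (slice q') {..x}" for x
      using cext_mono[OF C order_refl assms(1), of x] cext_nonneg[OF C, of x q]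
      by (simp add: emeasure_slice_atMost K(1) ennreal_plus[symmetric] del: ennreal_plus)
    show "emeasure (slice q) UNIV + emeasure (interval_measure ?F) UNIV = emeasure (slice q') UNIV"
      using clip_mono[OF assms(1)]
      by (simp add: emeasure_slice_UNIV K(2) ennreal_plus[symmetric] del: ennreal_plus)
  qed (use A in auto)
  then show ?thesis by (metis le_iff_add)
qed

text \<open>\<open>h q s\<close> stands for the conditional probability of Y \<open><= q\<close>
  given X = \<open>s\<close>. The bound 1 comes from \<open>slice q\<close> lying below
  \<open>slice 1\<close>, the uniform law. Monotonicity in \<open>q\<close> is only almost sure,
  with an exceptional set depending on the pair.\<close>

lemma exists_slice_densities:
  obtains h :: "real \<Rightarrow> real \<Rightarrow> real" where
    "\<And>q. q \<le> 1 \<Longrightarrow> h q \<in> borel_measurable borel"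
    "\<And>q s. q \<le> 1 \<Longrightarrow> h q s \<in> {0..1}"
    "\<And>q x. q \<le> 1 \<Longrightarrow> (\<integral>\<^sup>+s\<in>{..x}. ennreal (h q s) \<partial>unif) = cext C x q"
    "\<And>q q'. q \<le> q' \<Longrightarrow> q' \<le> 1 \<Longrightarrow> AE s in unif. h q s \<le> h q' s"
proof -
  have unif: "finite_measure unif"
    using prob_space_unif by (simp add: prob_space.axioms(1))
  have "\<exists>h::real \<Rightarrow> real. h \<in> borel_measurable borel \<and> (\<forall>s. 0 \<le> h s \<and> h s \<le> 1) \<and>
      (\<forall>A\<in>sets borel. emeasure (slice q) A = (\<integral>\<^sup>+s\<in>A. ennreal (h s) \<partial>unif))" if "q \<le> 1" for q
  proof -
    have "emeasure (slice q) A \<le> emeasure unif A" if "A \<in> sets unif" for A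
      using slice_mono[OF \<open>q \<le> 1\<close>, of A] that by (simp add: slice_one)
    from exists_density_le_one[OF unif finite_measure_slice _ this]
    obtain h where "h \<in> borel_measurable unif" "\<And>x. 0 \<le> h x" "\<And>x. h x \<le> 1"
      "\<And>A. A \<in> sets unif \<Longrightarrow> emeasure (slice q) A = (\<integral>\<^sup>+x\<in>A. ennreal (h x) \<partial>unif)"
      by auto
    then show ?thesis by (intro exI[of _ h]) auto
  qed
  then obtain h :: "real \<Rightarrow> real \<Rightarrow> real" where
    h: "\<And>q. q \<le> 1 \<Longrightarrow> h q \<in> borel_measurable borel"
       "\<And>q s. q \<le> 1 \<Longrightarrow> 0 \<le> h q s" "\<And>q s. q \<le> 1 \<Longrightarrow> h q s \<le> 1"
    and density: "\<And>q A. q \<le> 1 \<Longrightarrow> A \<in> sets borel \<Longrightarrow> emeasure (slice q) A = (\<integral>\<^sup>+s\<in>A. ennreal (h q s) \<partial>unif)"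
    by metis
  show ?thesis
  proof (rule that)
    show "(\<integral>\<^sup>+s\<in>{..x}. ennreal (h q s) \<partial>unif) = cext C x q" if "q \<le> 1" for q x
      using density[OF that, of "{..x}"] by (simp add: emeasure_slice_atMost)
    show "AE s in unif. h q s \<le> h q' s" if "q \<le> q'" "q' \<le> 1" for q q'
    proof (rule density_le_imp_AE_le[OF unif])
      show "(\<integral>\<^sup>+s\<in>A. ennreal (h q s) \<partial>unif) \<le> (\<integral>\<^sup>+s\<in>A. ennreal (h q' s) \<partial>unif)"
        if "A \<in> sets unif" for A
        using slice_mono[OF \<open>q \<le> q'\<close>, of A] that \<open>q \<le> q'\<close> \<open>q' \<le> 1\<close> by (simp add: density)
    qed (use that h in auto)
  qed (use h in auto)
qed

text \<open>The mass lies in the square, so setting one argument of the distribution function to 1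
  yields the uniform margins.\<close>

lemma is_copula_lawI:
  assumes "prob_space M" and sets: "sets M = sets borel"
    and square: "AE p in M. p \<in> unit_square"
    and cdf: "\<And>x y. x \<in> {0..1} \<Longrightarrow> y \<in> {0..1} \<Longrightarrow> measure M ({..x} \<times> {..y}) = C (x, y)"
  shows "is_copula_law C M"
proof -
  interpret prob_space M by fact
  have [measurable_cong]: "sets M = sets borel" by fact
  have rect [measurable]: "{..x} \<times> {..y} \<in> sets (borel :: (real \<times> real) measure)" for x y :: real
    by (intro borel_closed closed_Times) auto
  have [measurable]: "fst \<in> M \<rightarrow>\<^sub>M (borel :: real measure)" "snd \<in> M \<rightarrow>\<^sub>M (borel :: real measure)"
    by (auto simp: measurable_cong_sets[OF sets refl] intro!: borel_measurable_continuous_onI continuous_intros)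
  have space: "space M = UNIV" using sets_eq_imp_space_eq[OF sets] by simp
  have vimage: "fst -` {..x} \<in> sets M" "snd -` {..x} \<in> sets M" for x :: real
    using measurable_sets[of fst M borel "{..x}"] measurable_sets[of snd M borel "{..x}"]
    by (simp_all add: space)
  have "distr M borel fst = unif"
  proof (rule eq_unif)
    fix x :: real assume x: "x \<in> {0..1}"
    have "measure (distr M borel fst) {..x} = measure M (fst -` {..x})"
      by (simp add: measure_distr space)
    also have "\<dots> = measure M ({..x} \<times> {..1})"
      using square vimage by (intro finite_measure_eq_AE) (auto simp: sets)
    also have "\<dots> = x" using x cdf[of x 1] C by simp
    finally show "measure (distr M borel fst) {..x} = x" .
  qed (auto intro: prob_space_distr)
  moreover have "distr M borel snd = unif"
  proof (rule eq_unif)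
    fix x :: real assume x: "x \<in> {0..1}"
    have "measure (distr M borel snd) {..x} = measure M (snd -` {..x})"
      by (simp add: measure_distr space)
    also have "\<dots> = measure M ({..1} \<times> {..x})"
      using square vimage by (intro finite_measure_eq_AE) (auto simp: sets)
    also have "\<dots> = x" using x cdf[of 1 x] C by simp
    finally show "measure (distr M borel snd) {..x} = x" .
  qed (auto intro: prob_space_distr)
  ultimately show ?thesis
    unfolding is_copula_law_def using assms by blast
qed

end

lemma copula_law_exists:
  assumes C: "C \<in> copulas"
  shows "\<exists>M. is_copula_law C M"
proof -
  obtain h :: "real \<Rightarrow> real \<Rightarrow> real" where
    h_meas: "\<And>q. q \<le> 1 \<Longrightarrow> h q \<in> borel_measurable borel" and
    h_bound: "\<And>q s. q \<le> 1 \<Longrightarrow> h q s \<in> {0..1}" and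
    h_int: "\<And>q x. q \<le> 1 \<Longrightarrow> (\<integral>\<^sup>+s\<in>{..x}. ennreal (h q s) \<partial>unif) = cext C x q" and
    h_mono: "\<And>q q'. q \<le> q' \<Longrightarrow> q' \<le> 1 \<Longrightarrow> AE s in unif. h q s \<le> h q' s"
    using exists_slice_densities[OF C] by blast
  interpret U: prob_space unif by (rule prob_space_unif)
  define P where "P = unif \<Otimes>\<^sub>M unif"
  interpret P: pair_prob_space unif unif ..
  interpret prob_space P unfolding P_def by (rule P.prob_space_axioms)
  have sets_P [measurable_cong]: "sets P = sets (borel \<Otimes>\<^sub>M borel)"
    unfolding P_def by (intro sets_pair_measure_cong) auto
  have space_P: "space P = UNIV"
    using sets_eq_imp_space_eq[OF sets_P] by (simp add: space_pair_measure)
  \<comment> \<open>Countability merges the exceptional sets of all pairs of indices into one null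
    set and keeps the infimum below measurable.\<close>
  define Q :: "real set" where "Q = \<rat> \<inter> {0..1}"
  have Q: "countable Q" "0 \<in> Q" "\<And>q. q \<in> Q \<Longrightarrow> 0 \<le> q \<and> q \<le> 1"
    by (auto simp: Q_def countable_rat)
  have h_meas_Q [measurable]: "q \<in> Q \<Longrightarrow> h q \<in> borel_measurable borel" for q
    using h_meas Q(3) by blast

  have AE_fst: "AE p in P. R (fst p)"
    if "AE s in unif. R s" "Measurable.pred borel R" for R
  proof -
    have [measurable]: "Measurable.pred borel R" by fact
    show ?thesis unfolding P_def
    proof (rule P.AE_pair_measure)
      show "{p \<in> space (unif \<Otimes>\<^sub>M unif). R (fst p)} \<in> sets (unif \<Otimes>\<^sub>M unif)" by measurable
      show "AE s in unif. AE v in unif. R (fst (s, v))"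
        using that(1) by (rule AE_mp) simp
    qed
  qed

  \<comment> \<open>Given X = \<open>fst p\<close>, the independent uniform V = \<open>snd p\<close>
    falls below \<open>h q\<close> at X with probability \<open>h q\<close> at X. So
    \<open>E x q\<close> has the mass required of the event X \<open><= x\<close>, Y
    \<open><= q\<close>.\<close>
  define E where "E x q = {p. fst p \<le> x \<and> snd p \<le> h q (fst p)}" for x q
  have E_sets [measurable]: "E x q \<in> sets P" if "q \<in> Q" for x q
  proof -
    have [measurable]: "h q \<in> borel_measurable borel" using that by (rule h_meas_Q)
    have "{p \<in> space P. fst p \<le> x \<and> snd p \<le> h q (fst p)} \<in> sets P" by measurable
    then show ?thesis by (simp add: E_def space_P)
  qed
  have E_prob: "prob (E x q) = cext C x q" if "q \<in> Q" for x q
  proof -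
    have "emeasure P (E x q) = (\<integral>\<^sup>+s. emeasure unif (Pair s -` E x q) \<partial>unif)"
      unfolding P_def by (rule U.emeasure_pair_measure_alt, fold P_def, rule E_sets[OF that])
    also have "\<dots> = (\<integral>\<^sup>+s\<in>{..x}. ennreal (h q s) \<partial>unif)"
    proof (rule nn_integral_cong)
      fix s :: real
      have "Pair s -` E x q = (if s \<le> x then {..h q s} else {})" by (auto simp: E_def)
      moreover have "h q s \<in> {0..1}" using h_bound Q(3)[OF that] by blast
      ultimately show "emeasure unif (Pair s -` E x q) = ennreal (h q s) * indicator {..x} s"
        unfolding indicator_def by (simp add: emeasure_unif_atMost clip_id del: emeasure_uniform_measure)
    qed
    also have "\<dots> = cext C x q" using h_int Q(3)[OF that] by blast
    finally show ?thesis using cext_nonneg[OF C] by (simp add: emeasure_eq_measure)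
  qed

  \<comment> \<open>A failed test contributes 1, the largest value allowed for \<open>Y\<close>, so
    the infimum runs over all of \<open>Q\<close> and stays in [0, 1]. In \<open>Y_less\<close> the
    condition \<open>q <= 1\<close> rules out this default as a witness.\<close>
  define Y where "Y p = (INF q\<in>Q. if snd p \<le> h q (fst p) then q else 1)" for p
  have bdd: "bdd_below ((\<lambda>q. if snd p \<le> h q (fst p) then q else 1) ` Q)" for p
    using Q(3) by (auto intro!: bdd_belowI[of _ 0])
  have [measurable]: "Y \<in> borel_measurable P"
    unfolding Y_def using Q(1) by measurable
  have Y_le: "Y p \<le> q" if "q \<in> Q" "snd p \<le> h q (fst p)" for p q
    unfolding Y_def using that cINF_lower[OF bdd that(1), of p] by simp
  have Y_less: "\<exists>q'\<in>Q. q' < q \<and> snd p \<le> h q' (fst p)" if "Y p < q" "q \<le> 1" for p q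
  proof -
    have "\<exists>q'\<in>Q. (if snd p \<le> h q' (fst p) then q' else 1) < q"
      using that(1) Q(2) bdd[of p] unfolding Y_def by (subst (asm) cINF_less_iff) auto
    then show ?thesis using that(2) by (force split: if_splits)
  qed
  have Y_bound: "Y p \<in> {0..1}" for p
  proof -
    have "0 \<le> Y p" unfolding Y_def using Q by (intro cINF_greatest) auto
    moreover have "Y p \<le> (if snd p \<le> h 0 (fst p) then 0 else 1)"
      unfolding Y_def by (rule cINF_lower[OF bdd Q(2)])
    ultimately show ?thesis by (auto split: if_splits)
  qed

  define D where "D x y = {p. fst p \<le> x \<and> Y p \<le> y}" for x y
  have D_sets [measurable]: "D x y \<in> sets P" for x y
  proof -
    have "{p \<in> space P. fst p \<le> x \<and> Y p \<le> y} \<in> sets P" by measurable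
    then show ?thesis by (simp add: D_def space_P)
  qed
  have lower: "cext C x q \<le> prob (D x y)" if "q \<in> Q" "q \<le> y" for x y q
    unfolding E_prob[OF that(1), symmetric]
    using that(2) Y_le[OF that(1)] by (intro finite_measure_mono D_sets) (force simp: E_def D_def)
  \<comment> \<open>\<open>Y p < q\<close> supplies only some \<open>q' < q\<close> whose test
    succeeds. Passing from \<open>h q'\<close> to \<open>h q\<close> uses the almost sure
    monotonicity, so the inclusion holds up to a null set.\<close>
  have upper: "prob (D x y) \<le> cext C x q" if "q \<in> Q" "y < q" for x y q
    unfolding E_prob[OF that(1), symmetric]
  proof (rule finite_measure_mono_AE)
    have "AE s in unif. \<forall>q'\<in>Q. q' < q \<longrightarrow> h q' s \<le> h q s"
      using Q(1) h_mono Q(3)[OF that(1)] by (subst AE_ball_countable) auto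
    from AE_fst[OF this] have "AE p in P. \<forall>q'\<in>Q. q' < q \<longrightarrow> h q' (fst p) \<le> h q (fst p)"
      using Q(1) that(1) by measurable
    then show "AE p in P. p \<in> D x y \<longrightarrow> p \<in> E x q"
    proof (rule AE_mp, intro AE_I2 impI)
      fix p assume mono: "\<forall>q'\<in>Q. q' < q \<longrightarrow> h q' (fst p) \<le> h q (fst p)" and "p \<in> D x y"
      then have "fst p \<le> x" "Y p < q" using that by (auto simp: D_def)
      with Y_less[of p q] Q(3)[OF that(1)] mono show "p \<in> E x q"
        by (fastforce simp: E_def)
    qed
  qed (use that in auto)
  have fst_prob: "prob (D x y) \<le> clip x" for x y
  proof -
    have "emeasure P ({..x} \<times> UNIV) = ennreal (clip x)"
      using U.emeasure_pair_measure_Times[of "{..x}" unif UNIV] U.emeasure_space_1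
      by (simp add: P_def emeasure_unif_atMost del: emeasure_uniform_measure)
    moreover have "prob (D x y) \<le> prob ({..x} \<times> UNIV)"
      by (rule finite_measure_mono) (auto simp: D_def)
    ultimately show ?thesis by (simp add: emeasure_eq_measure)
  qed
  have D_prob: "prob (D x y) = C (x, y)" if xy: "x \<in> {0..1}" "y \<in> {0..1}" for x y
  proof (rule antisym)
    have ext: "cext C x y = C (x, y)" using xy by (simp add: cext_def clip_id)
    show "prob (D x y) \<le> C (x, y)"
    proof (cases "y = 1")
      \<comment> \<open>No index in \<open>Q\<close> exceeds \<open>y = 1\<close>, so the first
        margin supplies the bound here.\<close>
      case True
      then show ?thesis using fst_prob[of x 1] xy C by (simp add: clip_id)
    next
      case False
      show ?thesis
      \<comment> \<open>A rational index less than \<open>e\<close> above \<open>y\<close> costs at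
        most \<open>e\<close>, by the Lipschitz bound; the lower estimate approaches
        \<open>y\<close> from below in the same way.\<close>
      proof (rule field_le_epsilon)
        fix e :: real assume "0 < e"
        then obtain q where "q \<in> \<rat>" "y < q" "q < min 1 (y + e)"
          using False xy Rats_dense_in_real[of y "min 1 (y + e)"] by auto
        moreover from this have "q \<in> Q" using xy by (auto simp: Q_def)
        ultimately show "prob (D x y) \<le> C (x, y) + e"
          using upper[of q y x] cext_lipschitz[OF C, of x q x y] ext by auto
      qed
    qed
    show "C (x, y) \<le> prob (D x y)"
    proof (cases "y = 0")
      case True
      then show ?thesis using xy C by simp
    next
      case False
      show ?thesis
      proof (rule field_le_epsilon)
        fix e :: real assume "0 < e"
        then obtain q where "q \<in> \<rat>" "max 0 (y - e) < q" "q < y"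
          using False xy Rats_dense_in_real[of "max 0 (y - e)" y] by auto
        moreover from this have "q \<in> Q" using xy by (auto simp: Q_def)
        ultimately show "C (x, y) \<le> prob (D x y) + e"
          using lower[of q y x] cext_lipschitz[OF C, of x y x q] ext by auto
      qed
    qed
  qed

  have T [measurable]: "(\<lambda>p. (fst p, Y p)) \<in> P \<rightarrow>\<^sub>M borel"
    unfolding borel_prod[symmetric] by measurable
  have "is_copula_law C (distr P borel (\<lambda>p. (fst p, Y p)))"
  proof (rule is_copula_lawI[OF C])
    show "prob_space (distr P borel (\<lambda>p. (fst p, Y p)))" by (rule prob_space_distr) measurable
    show "AE p in distr P borel (\<lambda>p. (fst p, Y p)). p \<in> unit_square"
    proof (subst AE_distr_iff)
      have "closed unit_square" by (intro closed_Times) auto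
      then show "{p \<in> space borel. p \<in> unit_square} \<in> sets borel" by simp
      have "AE s in unif. s \<in> {0..1}" by (rule AE_uniform_measureI) auto
      from AE_fst[OF this] have "AE p in P. fst p \<in> {0..1}" by measurable
      then show "AE p in P. (fst p, Y p) \<in> unit_square"
        using Y_bound by (auto elim!: AE_mp)
    qed measurable
    show "measure (distr P borel (\<lambda>p. (fst p, Y p))) ({..x} \<times> {..y}) = C (x, y)"
      if "x \<in> {0..1}" "y \<in> {0..1}" for x y
    proof -
      have "closed ({..x} \<times> {..y})" by (intro closed_Times) auto
      then have "measure (distr P borel (\<lambda>p. (fst p, Y p))) ({..x} \<times> {..y}) = prob (D x y)"
        by (subst measure_distr) (auto simp: D_def space_P intro!: arg_cong[where f = prob])
      then show ?thesis using D_prob that by simp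
    qed
  qed simp
  then show ?thesis ..
qed

section \<open>Uniqueness of the law\<close>

lemma is_copula_law_atMost:
  assumes C: "C \<in> copulas" and M: "is_copula_law C M"
  shows "measure M ({..x} \<times> {..y}) = cext C x y"
proof -
  interpret prob_space M using M by (simp add: is_copula_law_def)
  have sets: "sets M = sets borel" using M by (simp add: is_copula_law_def)
  have "closed ({..x} \<times> {..y})" for x y :: real by (intro closed_Times) auto
  then have rect: "{..x} \<times> {..y} \<in> sets M" for x y by (simp add: sets)
  have square: "AE p in M. p \<in> unit_square" using M by (simp add: is_copula_law_def)
  have law: "measure M ({..x} \<times> {..y}) = C (x, y)" if "x \<in> {0..1}" "y \<in> {0..1}" for x y
    using M that by (simp add: is_copula_law_def)
  show ?thesis
  proof (cases "x < 0 \<or> y < 0")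
    \<comment> \<open>The rectangle misses the square, whereas its clipped version would still touch
      an edge, so the comparison is with the empty set.\<close>
    case True
    have "measure M ({..x} \<times> {..y}) = measure M {}"
      using square True rect by (intro finite_measure_eq_AE) auto
    then show ?thesis using True by (auto simp: cext_nonpos[OF C])
  next
    case False
    have "measure M ({..x} \<times> {..y}) = measure M ({..clip x} \<times> {..clip y})"
      using square False rect by (intro finite_measure_eq_AE) (auto simp: clip_def)
    then show ?thesis by (simp add: law cext_def)
  qed
qed

text \<open>Lower left quadrants are closed under intersection and generate the Borel sets; the
  previous lemma fixes their measure on the whole plane.\<close>

lemma is_copula_law_unique:
  assumes C: "C \<in> copulas" and M: "is_copula_law C M" and N: "is_copula_law C N"
  shows "M = N"
proof -
  interpret M: prob_space M using M by (simp add: is_copula_law_def)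
  interpret N: prob_space N using N by (simp add: is_copula_law_def)
  show ?thesis
  proof (rule measure_eqI_generator_eq[where \<Omega> = UNIV and E = "range (\<lambda>a::real \<times> real. {..a})"
        and A = "\<lambda>n. {..(real n, real n)}"])
    have atMost: "{..a} = {..fst a} \<times> {..snd a}" for a :: "real \<times> real"
      by (auto simp: less_eq_prod_def)
    show "Int_stable (range (\<lambda>a::real \<times> real. {..a}))"
    proof (rule Int_stableI_image)
      show "\<exists>c\<in>UNIV. {..a} \<inter> {..b} = {..c}" for a b :: "real \<times> real"
        by (intro bexI[of _ "inf a b"]) auto
    qed
    show "emeasure M X = emeasure N X" if "X \<in> range (\<lambda>a::real \<times> real. {..a})" for X
      using that by (auto simp: M.emeasure_eq_measure N.emeasure_eq_measure atMost
          is_copula_law_atMost[OF C M] is_copula_law_atMost[OF C N])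
    show "sets M = sigma_sets UNIV (range (\<lambda>a::real \<times> real. {..a}))"
      "sets N = sigma_sets UNIV (range (\<lambda>a::real \<times> real. {..a}))"
      using M N by (simp_all add: is_copula_law_def borel_eq_atMost[where 'a = "real \<times> real"])
    show "(\<Union>n. {..(real n, real n)}) = UNIV"
    proof (intro set_eqI iffI UNIV_I)
      fix p :: "real \<times> real"
      obtain n where "max (fst p) (snd p) \<le> real n" using real_arch_simple by blast
      then show "p \<in> (\<Union>n. {..(real n, real n)})" by (auto simp: less_eq_prod_def)
    qed
  qed (auto simp: M.emeasure_eq_measure)
qed

lemma is_copula_law_copula_law:
  assumes C: "C \<in> copulas"
  shows "is_copula_law C (copula_law C)"
proof -
  have "\<exists>!M. is_copula_law C M"
    using copula_law_exists[OF C] is_copula_law_unique[OF C] by blast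
  then show ?thesis unfolding copula_law_def by (rule theI')
qed

section \<open>Stop-loss transforms\<close>

text \<open>The probability of X \<open>> x\<close> and Y \<open>> y\<close>, by inclusion-exclusion
  with uniform margins.\<close>

definition survival :: "(real \<times> real \<Rightarrow> real) \<Rightarrow> real \<Rightarrow> real \<Rightarrow> real" where
  "survival C x y = 1 - clip x - clip y + cext C x y"

context
  fixes C :: "real \<times> real \<Rightarrow> real"
  assumes C: "C \<in> copulas"
begin

lemma measure_copula_law_greaterThan:
  "measure (copula_law C) ({x<..} \<times> {y<..}) = survival C x y"
proof -
  note law = is_copula_law_copula_law[OF C]
  interpret prob_space "copula_law C" using law by (simp add: is_copula_law_def)
  have sets: "sets (copula_law C) = sets borel" using law by (simp add: is_copula_law_def)
  have space: "space (copula_law C) = UNIV" using sets_eq_imp_space_eq[OF sets] by simp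
  have square: "AE p in copula_law C. p \<in> unit_square" using law by (simp add: is_copula_law_def)
  have "closed ({..x} \<times> {..y})" "closed ({..x} \<times> (UNIV :: real set))"
    "closed ((UNIV :: real set) \<times> {..y})" for x y :: real
    by (intro closed_Times; simp)+
  then have rect: "{..x} \<times> {..y} \<in> events" "{..x} \<times> UNIV \<in> events" "UNIV \<times> {..y} \<in> events" for x y
    by (simp_all add: sets)
  have "prob ({..x} \<times> UNIV) = prob ({..x} \<times> {..1})"
    using square rect by (intro finite_measure_eq_AE) auto
  then have x: "prob ({..x} \<times> UNIV) = clip x"
    by (simp add: is_copula_law_atMost[OF C law] cext_ge_one[OF C])
  have "prob (UNIV \<times> {..y}) = prob ({..1} \<times> {..y})"
    using square rect by (intro finite_measure_eq_AE) auto
  then have y: "prob (UNIV \<times> {..y}) = clip y"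
    by (simp add: is_copula_law_atMost[OF C law] cext_ge_one[OF C])
  have inter: "({..x} \<times> UNIV) \<inter> (UNIV \<times> {..y}) = {..x} \<times> {..y}" by auto
  have "prob ({..x} \<times> UNIV \<union> UNIV \<times> {..y}) = clip x + clip y - cext C x y"
    using measure_Un3[of "{..x} \<times> UNIV" "copula_law C" "UNIV \<times> {..y}"] rect
    by (simp add: x y inter is_copula_law_atMost[OF C law] fmeasurable_eq_sets)
  moreover have "{x<..} \<times> {y<..} = space (copula_law C) - ({..x} \<times> UNIV \<union> UNIV \<times> {..y})"
    by (auto simp: space)
  ultimately show ?thesis
    using prob_compl[of "{..x} \<times> UNIV \<union> UNIV \<times> {..y}"] rect by (simp add: survival_def)
qed

lemma survival_nonneg: "0 \<le> survival C x y"
  unfolding measure_copula_law_greaterThan[symmetric] by simp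

text \<open>Fubini for the length of \<open>{t - snd p<..<fst p}\<close>: a point \<open>s\<close>
  lies in it exactly when the first coordinate exceeds \<open>s\<close> and the second exceeds
  \<open>t - s\<close>.\<close>

lemma stop_loss_eq_survival:
  shows "integrable lborel (\<lambda>s. survival C s (t - s))"
    and "stop_loss C t = (LINT s|lborel. survival C s (t - s))"
proof -
  note law = is_copula_law_copula_law[OF C]
  let ?M = "copula_law C"
  interpret prob_space ?M using law by (simp add: is_copula_law_def)
  interpret pair_sigma_finite ?M lborel ..
  have sets [measurable_cong]: "sets ?M = sets (borel \<Otimes>\<^sub>M borel)"
    unfolding borel_prod using law by (simp add: is_copula_law_def)
  have square: "AE p in ?M. p \<in> unit_square" using law by (simp add: is_copula_law_def)
  let ?f = "\<lambda>p::real \<times> real. max (fst p + snd p - t) 0"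
  have meas: "(\<lambda>s. survival C s (t - s)) \<in> borel_measurable lborel"
    unfolding survival_def clip_def measurable_lborel2
    by (intro borel_measurable_continuous_onI continuous_intros continuous_on_cext[OF C])
  have "(\<integral>\<^sup>+p. ennreal (?f p) \<partial>?M) = (\<integral>\<^sup>+p. (\<integral>\<^sup>+s. indicator {t - snd p<..<fst p} s \<partial>lborel) \<partial>?M)"
  proof (intro nn_integral_cong)
    fix p :: "real \<times> real"
    show "ennreal (?f p) = (\<integral>\<^sup>+s. indicator {t - snd p<..<fst p} s \<partial>lborel)"
      by (cases "t - snd p \<le> fst p") (auto simp: max_def algebra_simps)
  qed
  also have "\<dots> = (\<integral>\<^sup>+s. (\<integral>\<^sup>+p. indicator {t - snd p<..<fst p} s \<partial>?M) \<partial>lborel)"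
    by (rule Fubini'[symmetric]) (simp add: indicator_def, measurable)
  also have "\<dots> = (\<integral>\<^sup>+s. ennreal (survival C s (t - s)) \<partial>lborel)"
  proof (intro nn_integral_cong)
    fix s :: real
    have "open ({s<..} \<times> {t - s<..})" by (intro open_Times) auto
    then have [measurable]: "{s<..} \<times> {t - s<..} \<in> sets ?M"
      using law by (simp add: is_copula_law_def)
    have "(\<integral>\<^sup>+p. indicator {t - snd p<..<fst p} s \<partial>?M) = (\<integral>\<^sup>+p. indicator ({s<..} \<times> {t - s<..}) p \<partial>?M)"
      by (intro nn_integral_cong) (auto simp: indicator_def)
    also have "\<dots> = emeasure ?M ({s<..} \<times> {t - s<..})" by simp
    finally show "(\<integral>\<^sup>+p. indicator {t - snd p<..<fst p} s \<partial>?M) = ennreal (survival C s (t - s))"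
      by (simp add: emeasure_eq_measure measure_copula_law_greaterThan)
  qed
  finally have eq: "(\<integral>\<^sup>+p. ennreal (?f p) \<partial>?M) = (\<integral>\<^sup>+s. ennreal (survival C s (t - s)) \<partial>lborel)" .
  have "(\<integral>\<^sup>+p. ennreal (?f p) \<partial>?M) \<le> (\<integral>\<^sup>+p. ennreal (2 + \<bar>t\<bar>) \<partial>?M)"
  \<comment> \<open>The payoff is bounded on the square that carries the law. The common value of
    both integrals is thus finite, which makes the survival function integrable along the
    line.\<close>
  proof (rule nn_integral_mono_AE)
    show "AE p in ?M. ennreal (?f p) \<le> ennreal (2 + \<bar>t\<bar>)"
      using square
    proof eventually_elim
      case (elim p)
      then have "fst p \<le> 1" "snd p \<le> 1" by auto
      then show ?case by (intro ennreal_leI) linarith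
    qed
  qed
  also have "\<dots> < \<infinity>" by (simp add: emeasure_space_1 less_top)
  finally have "(\<integral>\<^sup>+s. ennreal (survival C s (t - s)) \<partial>lborel) < \<infinity>" unfolding eq .
  then show "integrable lborel (\<lambda>s. survival C s (t - s))"
    using meas survival_nonneg by (intro integrableI_nonneg) auto
  have "stop_loss C t = (LINT p|?M. ?f p)"
    unfolding stop_loss_def case_prod_unfold ..
  also have "\<dots> = enn2real (\<integral>\<^sup>+p. ennreal (?f p) \<partial>?M)"
    by (rule integral_eq_nn_integral) auto
  also have "\<dots> = (LINT s|lborel. survival C s (t - s))"
    unfolding eq using meas survival_nonneg by (intro integral_eq_nn_integral[symmetric]) auto
  finally show "stop_loss C t = (LINT s|lborel. survival C s (t - s))" .
qed

end

text \<open>The margins enter \<open>survival\<close> identically for all copulas and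
  cancel.\<close>

lemma stop_loss_diff:
  assumes "A \<in> copulas" "B \<in> copulas"
  shows "integrable lborel (\<lambda>s. cext A s (t - s) - cext B s (t - s))"
    and "stop_loss A t - stop_loss B t = (LINT s|lborel. cext A s (t - s) - cext B s (t - s))"
proof -
  have eq: "cext A s (t - s) - cext B s (t - s) = survival A s (t - s) - survival B s (t - s)" for s
    by (simp add: survival_def)
  note A = stop_loss_eq_survival[OF assms(1), of t] and B = stop_loss_eq_survival[OF assms(2), of t]
  show "integrable lborel (\<lambda>s. cext A s (t - s) - cext B s (t - s))"
    unfolding eq by (rule Bochner_Integration.integrable_diff[OF A(1) B(1)])
  show "stop_loss A t - stop_loss B t = (LINT s|lborel. cext A s (t - s) - cext B s (t - s))"
    unfolding eq A(2) B(2) by (rule Bochner_Integration.integral_diff[OF A(1) B(1), symmetric])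
qed

section \<open>Uniform distance and comparison of stop-loss transforms\<close>

lemma copula_dist_upper:
  assumes "A \<in> copulas" "B \<in> copulas" "p \<in> unit_square"
  shows "\<bar>A p - B p\<bar> \<le> copula_dist A B"
proof -
  have "bdd_above ((\<lambda>p. \<bar>A p - B p\<bar>) ` unit_square)"
  proof (rule bdd_aboveI2)
    fix p :: "real \<times> real" assume "p \<in> unit_square"
    then have "A p = cext A (fst p) (snd p)" "B p = cext B (fst p) (snd p)"
      by (auto simp: cext_def clip_id)
    then show "\<bar>A p - B p\<bar> \<le> 1"
      using cext_nonneg[OF assms(1), of "fst p" "snd p"] cext_le(1)[OF assms(1), of "fst p" "snd p"]
        cext_nonneg[OF assms(2), of "fst p" "snd p"] cext_le(1)[OF assms(2), of "fst p" "snd p"]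
        clip_bounds(2)[of "fst p"]
      by linarith
  qed
  then show ?thesis
    using cSUP_upper[OF assms(3)] assms(1,2) by (simp add: copula_dist_def)
qed

lemma copula_dist_leI:
  assumes "A \<in> copulas" "B \<in> copulas"
    and "\<And>x y. x \<in> {0..1} \<Longrightarrow> y \<in> {0..1} \<Longrightarrow> \<bar>A (x, y) - B (x, y)\<bar> \<le> c"
  shows "copula_dist A B \<le> c"
proof -
  have "(SUP p\<in>unit_square. \<bar>A p - B p\<bar>) \<le> c"
  proof (rule cSUP_least)
    show "\<bar>A p - B p\<bar> \<le> c" if "p \<in> unit_square" for p
      using assms(3)[of "fst p" "snd p"] that by (cases p) simp
  qed simp
  then show ?thesis using assms(1,2) by (simp add: copula_dist_def)
qed

text \<open>For \<open>s\<close> outside [0, 1] both extended copulas equal the same margin or 0, so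
  the difference is integrated over an interval of length 1 only. The bound is uniform in
  \<open>t\<close>.\<close>

lemma stop_loss_lipschitz:
  assumes A: "A \<in> copulas" and B: "B \<in> copulas"
  shows "\<bar>stop_loss A t - stop_loss B t\<bar> \<le> copula_dist A B"
proof -
  let ?d = "\<lambda>s. cext A s (t - s) - cext B s (t - s)"
  have le: "\<bar>?d s\<bar> \<le> copula_dist A B * indicator {0..1} s" for s
  proof (cases "s \<in> {0..1}")
    case True
    then show ?thesis
      using copula_dist_upper[OF A B, of "(clip s, clip (t - s))"] by (simp add: cext_def)
  next
    case False
    then consider "s \<le> 0" | "1 \<le> s" by fastforce
    then have "?d s = 0"
      by cases (simp_all add: cext_nonpos[OF A] cext_nonpos[OF B] cext_ge_one[OF A] cext_ge_one[OF B])
    with False show ?thesis by simp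
  qed
  have "\<bar>LINT s|lborel. ?d s\<bar> \<le> (LINT s|lborel. \<bar>?d s\<bar>)"
    using integral_norm_bound[of lborel ?d] by simp
  also have "\<dots> \<le> (LINT s|lborel. copula_dist A B * indicator {0..1::real} s)"
  proof (rule Bochner_Integration.integral_mono)
    show "integrable lborel (\<lambda>s. \<bar>?d s\<bar>)"
      by (intro integrable_abs stop_loss_diff(1)[OF A B])
    show "integrable lborel (\<lambda>s. copula_dist A B * indicator {0..1::real} s)"
      by (intro integrable_mult_right integrable_real_indicator) (auto simp: emeasure_lborel_Icc_eq)
  qed (rule le)
  also have "\<dots> = copula_dist A B" by simp
  finally show ?thesis by (simp add: stop_loss_diff(2)[OF A B])
qed

text \<open>The order along the line gives a weak inequality; the gap \<open>e\<close> over an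
  interval of positive length makes it strict.\<close>

lemma stop_loss_less:
  assumes A: "A \<in> copulas" and B: "B \<in> copulas"
    and le: "\<And>s. cext A s (t - s) \<le> cext B s (t - s)"
    and gap: "0 < e" "\<And>s. s \<in> {a..b} \<Longrightarrow> cext A s (t - s) + e \<le> cext B s (t - s)" and "a < b"
  shows "stop_loss A t < stop_loss B t"
proof -
  have ind: "integrable lborel (indicat_real {a..b})"
    by (rule integrable_real_indicator) (auto simp: emeasure_lborel_Icc_eq)
  have "0 < (LINT s|lborel. e * indicator {a..b} s)" using gap(1) \<open>a < b\<close> by simp
  also have "\<dots> \<le> (LINT s|lborel. cext B s (t - s) - cext A s (t - s))"
  proof (rule Bochner_Integration.integral_mono)
    show "integrable lborel (\<lambda>s. cext B s (t - s) - cext A s (t - s))"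
      by (rule stop_loss_diff(1)[OF B A])
    show "e * indicator {a..b} s \<le> cext B s (t - s) - cext A s (t - s)" for s
      using le[of s] gap(2)[of s] by (auto simp: indicator_def)
  qed (use ind in simp)
  finally show ?thesis using stop_loss_diff(2)[OF B A, of t] by simp
qed

section \<open>Ordinal sums\<close>

text \<open>\<open>copula_M\<close> and \<open>copula_W\<close> are the Frechet-Hoeffding bounds,
  the laws of comonotone and countermonotone uniform pairs.\<close>

definition copula_M :: "real \<times> real \<Rightarrow> real" where
  "copula_M = restrict (\<lambda>(x, y). min x y) unit_square"

definition copula_W :: "real \<times> real \<Rightarrow> real" where
  "copula_W = restrict (\<lambda>(x, y). max (x + y - 1) 0) unit_square"

lemma copula_M: "copula_M \<in> copulas"
  by (rule copulasI) (auto simp: copula_M_def min_def)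

lemma copula_W: "copula_W \<in> copulas"
  by (rule copulasI) (auto simp: copula_W_def max_def)

lemma cext_M: "cext copula_M x y = min (clip x) (clip y)"
  by (simp add: cext_def copula_M_def)

lemma cext_W_antidiagonal: "x + y = 1 \<Longrightarrow> cext copula_W x y = 0"
  by (auto simp: cext_def copula_W_def clip_def)

text \<open>
  Clipping makes both summands 2-increasing on the whole square, so no case distinction on the blocks
  \<open>[0, a]\<^sup>2\<close> and \<open>[a, 1]\<^sup>2\<close> is needed.
\<close>

definition ordinal_sum ::
    "real \<Rightarrow> (real \<times> real \<Rightarrow> real) \<Rightarrow> (real \<times> real \<Rightarrow> real) \<Rightarrow> real \<times> real \<Rightarrow> real" where
  "ordinal_sum a C1 C2 = restrict (\<lambda>(x, y). a * cext C1 (x / a) (y / a) +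
     (1 - a) * cext C2 ((x - a) / (1 - a)) ((y - a) / (1 - a))) unit_square"

context
  fixes a :: real and C1 C2 :: "real \<times> real \<Rightarrow> real"
  assumes a: "0 < a" "a < 1" and C1: "C1 \<in> copulas" and C2: "C2 \<in> copulas"
begin

lemma ordinal_sum_copula: "ordinal_sum a C1 C2 \<in> copulas"
proof (rule copulasI)
  have one: "1 \<le> 1 / a" "1 \<le> (1 - a) / (1 - a)" using a by (simp_all add: field_simps)
  have zero: "(0 - a) / (1 - a) \<le> 0" using a by (simp add: divide_le_0_iff)
  \<comment> \<open>The margin of the sum: the blocks carry mass \<open>a\<close> and
    \<open>1 - a\<close>, filled one after the other as \<open>t\<close> runs through
    [0, 1].\<close>
  have split: "a * clip (t / a) + (1 - a) * clip ((t - a) / (1 - a)) = t" if "t \<in> {0..1}" for t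
  proof (cases "t \<le> a")
    case True
    then have "clip (t / a) = t / a" "clip ((t - a) / (1 - a)) = 0"
      using a that by (auto intro!: clip_id clip_nonpos simp: divide_le_0_iff)
    then show ?thesis using a by simp
  next
    case False
    then have "clip (t / a) = 1"
      using a by (intro clip_ge_one) (simp add: field_simps)
    moreover have "clip ((t - a) / (1 - a)) = (t - a) / (1 - a)"
      using False a that by (intro clip_id) (auto simp: field_simps)
    moreover have "a * 1 + (1 - a) * ((t - a) / (1 - a)) = t" using a by simp
    ultimately show ?thesis by (simp only:)
  qed
  show "ordinal_sum a C1 C2 \<in> extensional unit_square" by (simp add: ordinal_sum_def)
  fix t :: real assume t: "t \<in> {0..1}"
  show "ordinal_sum a C1 C2 (t, 0) = 0" "ordinal_sum a C1 C2 (0, t) = 0"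
    using t zero by (simp_all add: ordinal_sum_def cext_nonpos[OF C1] cext_nonpos[OF C2])
  show "ordinal_sum a C1 C2 (t, 1) = t" "ordinal_sum a C1 C2 (1, t) = t"
    using t one split[OF t] by (simp_all add: ordinal_sum_def cext_ge_one[OF C1] cext_ge_one[OF C2])
next
  fix u u' v v' :: real
  assume mem: "u \<in> {0..1}" "u' \<in> {0..1}" "v \<in> {0..1}" "v' \<in> {0..1}" and le: "u \<le> u'" "v \<le> v'"
  have 1: "0 \<le> a * (cext C1 (u' / a) (v' / a) - cext C1 (u / a) (v' / a)
      - cext C1 (u' / a) (v / a) + cext C1 (u / a) (v / a))"
    using a le by (intro mult_nonneg_nonneg cext_rect[OF C1] divide_right_mono) auto
  have 2: "0 \<le> (1 - a) * (cext C2 ((u' - a) / (1 - a)) ((v' - a) / (1 - a))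
      - cext C2 ((u - a) / (1 - a)) ((v' - a) / (1 - a))
      - cext C2 ((u' - a) / (1 - a)) ((v - a) / (1 - a))
      + cext C2 ((u - a) / (1 - a)) ((v - a) / (1 - a)))"
    using a le by (intro mult_nonneg_nonneg cext_rect[OF C2] divide_right_mono) auto
  show "0 \<le> ordinal_sum a C1 C2 (u', v') - ordinal_sum a C1 C2 (u, v')
      - ordinal_sum a C1 C2 (u', v) + ordinal_sum a C1 C2 (u, v)"
    using 1 2 mem unfolding ordinal_sum_def by (simp add: algebra_simps del: divide_eq_0_iff)
qed

lemma cext_ordinal_sum:
  "cext (ordinal_sum a C1 C2) x y =
    a * cext C1 (x / a) (y / a) + (1 - a) * cext C2 ((x - a) / (1 - a)) ((y - a) / (1 - a))"
  using a by (simp add: cext_def ordinal_sum_def clip_divide_clip clip_rescale_clip)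

text \<open>Rescaling moves each coordinate by at most \<open>a\<close>, which costs
  \<open>2 * a\<close> by the Lipschitz bound. Exchanging mass \<open>a\<close> between the two
  summands costs another \<open>a\<close>.\<close>

lemma copula_dist_ordinal_sum: "copula_dist (ordinal_sum a C1 C2) C2 \<le> 3 * a"
proof (rule copula_dist_leI[OF ordinal_sum_copula C2])
  fix x y :: real assume xy: "x \<in> {0..1}" "y \<in> {0..1}"
  have shift: "\<bar>clip ((x - a) / (1 - a)) - x\<bar> \<le> a" if "x \<in> {0..1}" for x
  proof (cases "x \<le> a")
    case True
    then have "clip ((x - a) / (1 - a)) = 0" using a by (intro clip_nonpos) (simp add: divide_le_0_iff)
    then show ?thesis using True that by simp
  next
    case False
    then have "clip ((x - a) / (1 - a)) = (x - a) / (1 - a)"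
      using a that by (intro clip_id) (auto simp: field_simps)
    moreover have "x - (x - a) / (1 - a) = a * ((1 - x) / (1 - a))"
      using a by (simp add: field_simps)
    moreover have "0 \<le> (1 - x) / (1 - a)" "(1 - x) / (1 - a) \<le> 1"
      using a that False by (simp_all add: field_simps)
    then have "0 \<le> a * ((1 - x) / (1 - a))" "a * ((1 - x) / (1 - a)) \<le> a"
      using a(1) mult_left_le[of "(1 - x) / (1 - a)" a] by (auto intro!: mult_nonneg_nonneg simp del: times_divide_eq_right)
    ultimately show ?thesis by linarith
  qed
  define c where "c = cext C2 ((x - a) / (1 - a)) ((y - a) / (1 - a))"
  have "c = cext C2 (clip ((x - a) / (1 - a))) (clip ((y - a) / (1 - a)))"
    by (simp add: c_def cext_def)
  then have "\<bar>c - cext C2 x y\<bar> \<le> 2 * a"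
    using cext_lipschitz[OF C2, of "clip ((x - a) / (1 - a))" "clip ((y - a) / (1 - a))" x y]
      shift[OF xy(1)] shift[OF xy(2)] by linarith
  moreover have bound: "0 \<le> cext C p q" "cext C p q \<le> 1" if "C \<in> copulas" for C p q
    using cext_nonneg[OF that] order_trans[OF cext_le(1)[OF that] clip_bounds(2)] by auto
  have "0 \<le> a * cext C1 (x / a) (y / a)" "a * cext C1 (x / a) (y / a) \<le> a" "0 \<le> a * c" "a * c \<le> a"
    using a bound[OF C1] bound[OF C2] by (simp_all add: c_def mult_left_le)
  moreover have "ordinal_sum a C1 C2 (x, y) = a * cext C1 (x / a) (y / a) + c - a * c"
    using xy by (simp add: ordinal_sum_def c_def algebra_simps)
  moreover have "C2 (x, y) = cext C2 x y" using xy by (simp add: cext_def clip_id)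
  ultimately show "\<bar>ordinal_sum a C1 C2 (x, y) - C2 (x, y)\<bar> \<le> 3 * a" by linarith
qed

text \<open>One coordinate has not yet entered the second block, even where the line leaves the
  first one. The line integral therefore does not see \<open>C2\<close>.\<close>

lemma cext_ordinal_sum_low:
  assumes "x + y \<le> 2 * a"
  shows "cext (ordinal_sum a C1 C2) x y = a * cext C1 (x / a) (y / a)"
proof -
  have "x \<le> a \<or> y \<le> a" using assms by linarith
  then have "(x - a) / (1 - a) \<le> 0 \<or> (y - a) / (1 - a) \<le> 0"
    using a by (simp add: divide_le_0_iff)
  then show ?thesis unfolding cext_ordinal_sum by (simp add: cext_nonpos[OF C2])
qed

text \<open>One coordinate has passed the first block, so \<open>C1\<close> enters through a margin
  only and its dependence structure disappears.\<close>

lemma cext_ordinal_sum_high: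
  assumes "2 * a \<le> x + y"
  shows "cext (ordinal_sum a C1 C2) x y =
    a * min (clip (x / a)) (clip (y / a)) + (1 - a) * cext C2 ((x - a) / (1 - a)) ((y - a) / (1 - a))"
proof -
  have "a \<le> x \<or> a \<le> y" using assms by linarith
  then have "1 \<le> x / a \<or> 1 \<le> y / a" using a by (simp add: field_simps)
  then have "cext C1 (x / a) (y / a) = min (clip (x / a)) (clip (y / a))"
    by (auto simp: cext_ge_one[OF C1] clip_ge_one min_def antisym)
  then show ?thesis unfolding cext_ordinal_sum by simp
qed

end

section \<open>Two copulas whose stop-loss transforms cross\<close>

abbreviation "sum_MW \<equiv> ordinal_sum (1/2) copula_M copula_W"
abbreviation "sum_WM \<equiv> ordinal_sum (1/2) copula_W copula_M"

lemma sum_MW: "sum_MW \<in> copulas" and sum_WM: "sum_WM \<in> copulas"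
  by (auto intro: ordinal_sum_copula copula_M copula_W)

lemma min_clip_antidiagonal:
  assumes "x + y = 1" "x \<in> {1/4..3/4}"
  shows "1/4 \<le> min (clip x) (clip y)"
  using assms by (auto simp: clip_id)

text \<open>The line is the antidiagonal of the lower block, where the countermonotone copula
  vanishes; 1/8 is the block weight 1/2 times the bound 1/4 for the comonotone one.\<close>

lemma antidiagonal_half:
  assumes "x + y = 1/2"
  shows "cext sum_WM x y = 0" "0 \<le> cext sum_MW x y"
    and "x \<in> {1/8..3/8} \<Longrightarrow> 1/8 \<le> cext sum_MW x y"
proof -
  have "cext copula_W (x / (1/2)) (y / (1/2)) = 0"
    using assms by (intro cext_W_antidiagonal) simp
  then show "cext sum_WM x y = 0"
    using assms by (subst cext_ordinal_sum_low) (auto intro: copula_M copula_W)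
  show "0 \<le> cext sum_MW x y" by (rule cext_nonneg[OF sum_MW])
  assume "x \<in> {1/8..3/8}"
  then have "1/4 \<le> min (clip (x / (1/2))) (clip (y / (1/2)))"
    using assms by (intro min_clip_antidiagonal) auto
  then show "1/8 \<le> cext sum_MW x y"
    using assms by (subst cext_ordinal_sum_low) (auto intro: copula_M copula_W simp: cext_M)
qed

text \<open>The same comparison on the antidiagonal of the upper block, where the two copulas have
  exchanged roles.\<close>

lemma antidiagonal_three_halves:
  assumes "x + y = 3/2"
  shows "cext sum_MW x y \<le> cext sum_WM x y"
    and "x \<in> {5/8..7/8} \<Longrightarrow> cext sum_MW x y + 1/8 \<le> cext sum_WM x y"
proof -
  \<comment> \<open>The contribution of the lower block, equal for both sums since only its margins
    matter beyond \<open>x + y = 1\<close>.\<close>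
  define m where "m = 1/2 * min (clip (x / (1/2))) (clip (y / (1/2)))"
  have "cext copula_W ((x - 1/2) / (1 - 1/2)) ((y - 1/2) / (1 - 1/2)) = 0"
    using assms by (intro cext_W_antidiagonal) (simp add: field_simps)
  then have MW: "cext sum_MW x y = m"
    using assms by (subst cext_ordinal_sum_high) (auto intro: copula_M copula_W simp: m_def)
  have WM: "cext sum_WM x y = m + 1/2 * min (clip ((x - 1/2) / (1 - 1/2))) (clip ((y - 1/2) / (1 - 1/2)))"
    using assms by (subst cext_ordinal_sum_high) (auto intro: copula_M copula_W simp: m_def cext_M)
  show "cext sum_MW x y \<le> cext sum_WM x y" unfolding MW WM by simp
  assume "x \<in> {5/8..7/8}"
  then have "1/4 \<le> min (clip ((x - 1/2) / (1 - 1/2))) (clip ((y - 1/2) / (1 - 1/2)))"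
    using assms by (intro min_clip_antidiagonal) (auto simp: field_simps)
  then show "cext sum_MW x y + 1/8 \<le> cext sum_WM x y" unfolding MW WM by linarith
qed

text \<open>Both lines satisfy \<open>t <= 2 * a\<close>, so only the scaled first block counts,
  whatever \<open>A\<close> and \<open>B\<close> are. The thresholds are 1/2 and 3/2 scaled by
  \<open>a\<close>, and the gap 1/8 scales to \<open>a * (1/8)\<close>.\<close>

lemma perturbation_incomparable:
  assumes a: "0 < a" "a < 1" and A: "A \<in> copulas" and B: "B \<in> copulas"
  shows "stop_loss (ordinal_sum a sum_WM B) (a / 2) < stop_loss (ordinal_sum a sum_MW A) (a / 2)"
    and "stop_loss (ordinal_sum a sum_MW A) (3 * a / 2) < stop_loss (ordinal_sum a sum_WM B) (3 * a / 2)"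
proof -
  let ?A = "ordinal_sum a sum_MW A" and ?B = "ordinal_sum a sum_WM B"
  have A': "?A \<in> copulas" and B': "?B \<in> copulas"
    using a A B by (auto intro: ordinal_sum_copula sum_MW sum_WM)
  have low: "cext ?A s (t - s) = a * cext sum_MW (s / a) ((t - s) / a)"
    "cext ?B s (t - s) = a * cext sum_WM (s / a) ((t - s) / a)" if "t \<le> 2 * a" for s t
    using a A B that by (auto intro!: cext_ordinal_sum_low sum_MW sum_WM)
  have gap: "a * p + a * (1/8) \<le> a * q" if "p + 1/8 \<le> q" for p q
    using mult_left_mono[OF that, of a] a by (simp add: algebra_simps)
  show "stop_loss ?B (a / 2) < stop_loss ?A (a / 2)"
  proof (rule stop_loss_less[OF B' A', where e = "a * (1/8)" and a = "a/8" and b = "3*a/8"])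
    fix s
    have half: "s / a + (a / 2 - s) / a = 1/2" using a by (simp add: field_simps)
    note anti = antidiagonal_half[OF half]
    have le: "a / 2 \<le> 2 * a" using a by simp
    show "cext ?B s (a / 2 - s) \<le> cext ?A s (a / 2 - s)"
      unfolding low[OF le] using a anti by simp
    show "cext ?B s (a / 2 - s) + a * (1/8) \<le> cext ?A s (a / 2 - s)" if "s \<in> {a/8..3*a/8}"
    proof -
      have "s / a \<in> {1/8..3/8}" using that a by (simp add: field_simps)
      then show ?thesis unfolding low[OF le] using anti by (intro gap) simp
    qed
  qed (use a in auto)
  show "stop_loss ?A (3 * a / 2) < stop_loss ?B (3 * a / 2)"
  proof (rule stop_loss_less[OF A' B', where e = "a * (1/8)" and a = "5*a/8" and b = "7*a/8"])
    fix s
    have half: "s / a + (3 * a / 2 - s) / a = 3/2" using a by (simp add: field_simps)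
    note anti = antidiagonal_three_halves[OF half]
    have le: "3 * a / 2 \<le> 2 * a" using a by simp
    show "cext ?A s (3 * a / 2 - s) \<le> cext ?B s (3 * a / 2 - s)"
      unfolding low[OF le] using a anti(1) by (intro mult_left_mono) auto
    show "cext ?A s (3 * a / 2 - s) + a * (1/8) \<le> cext ?B s (3 * a / 2 - s)" if "s \<in> {5*a/8..7*a/8}"
    proof -
      have "s / a \<in> {5/8..7/8}" using that a by (simp add: field_simps)
      then show ?thesis unfolding low[OF le] using anti(2) by (intro gap)
    qed
  qed (use a in auto)
qed

section \<open>Incomparability is open and dense\<close>

theorem proposition10:
  shows "closedin (Metric_space.mtopology (copulas \<times> copulas) (max_dist copula_dist copula_dist)) P_sl \<and>
         nowhere_dense_in (Metric_space.mtopology (copulas \<times> copulas) (max_dist copula_dist copula_dist)) P_sl"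
proof -
  let ?d = "max_dist copula_dist copula_dist"
  interpret C: Metric_space copulas copula_dist by (rule Metric_space_copulas)
  interpret Metric_space "copulas \<times> copulas" ?d
    by (rule Metric_space_max_dist[OF Metric_space_copulas Metric_space_copulas])
  have ball: "(A', B') \<in> mball (A, B) r \<longleftrightarrow> A \<in> copulas \<and> B \<in> copulas \<and> A' \<in> copulas \<and> B' \<in> copulas \<and>
      copula_dist A A' < r \<and> copula_dist B B' < r" for A B A' B' r
  proof -
    have "?d (A, B) (A', B') = max (copula_dist A A') (copula_dist B B')"
      by (simp add: max_dist_def)
    then show ?thesis by (auto simp: in_mball)
  qed
  have closed: "closedin mtopology P_sl"
    unfolding closedin_def openin_mtopology topspace_mtopology
  proof (intro conjI allI impI)
    show "P_sl \<subseteq> copulas \<times> copulas" by (auto simp: P_sl_def)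
    fix p assume "p \<in> copulas \<times> copulas - P_sl"
    then obtain A B where p: "p = (A, B)" "A \<in> copulas" "B \<in> copulas"
      and "\<not> A \<le>\<^sub>s\<^sub>l B" "\<not> B \<le>\<^sub>s\<^sub>l A" by (auto simp: P_sl_def)
    then obtain t u where t: "stop_loss B t < stop_loss A t" and u: "stop_loss A u < stop_loss B u"
      by (auto simp: sl_le_def not_le)
    \<comment> \<open>Half the smaller gap: both transforms move by less than \<open>r\<close> at
      each threshold, so neither strict inequality can be reversed or become an equality.\<close>
    define r where "r = min (stop_loss A t - stop_loss B t) (stop_loss B u - stop_loss A u) / 2"
    have "mball (A, B) r \<subseteq> copulas \<times> copulas - P_sl"
    proof (rule subsetI)
      fix q assume q: "q \<in> mball (A, B) r"
      obtain A' B' where eq: "q = (A', B')" by (cases q)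
      have mem: "A' \<in> copulas" "B' \<in> copulas" and "copula_dist A A' < r" "copula_dist B B' < r"
        using q unfolding eq ball by auto
      then have "\<bar>stop_loss A v - stop_loss A' v\<bar> < r" "\<bar>stop_loss B v - stop_loss B' v\<bar> < r" for v
        using stop_loss_lipschitz[OF p(2) mem(1), of v] stop_loss_lipschitz[OF p(3) mem(2), of v] by auto
      note close = this[of t] this[of u]
      have "r \<le> (stop_loss A t - stop_loss B t) / 2" "r \<le> (stop_loss B u - stop_loss A u) / 2"
        by (simp_all add: r_def)
      with close have "stop_loss B' t < stop_loss A' t" "stop_loss A' u < stop_loss B' u" by argo+
      then show "q \<in> copulas \<times> copulas - P_sl"
        using mem unfolding eq by (auto simp: P_sl_def sl_le_def not_le[symmetric])
    qed
    moreover have "0 < r" using t u by (simp add: r_def)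
    ultimately show "\<exists>r>0. mball p r \<subseteq> copulas \<times> copulas - P_sl" using p(1) by blast
  qed auto
  moreover have "nowhere_dense_in mtopology P_sl"
    \<comment> \<open>A closed set is its own closure, so it suffices to find an incomparable pair
      in every ball around a point of the set.\<close>
    unfolding nowhere_dense_in_def closure_of_closedin[OF closed]
  proof (intro conjI equals0I)
    show "P_sl \<subseteq> topspace mtopology" using closedin_subset[OF closed] .
    fix p assume "p \<in> mtopology interior_of P_sl"
    then obtain T where "openin mtopology T" "p \<in> T" and T: "T \<subseteq> P_sl"
      by (auto simp: interior_of_def)
    then obtain r where "0 < r" and r: "mball p r \<subseteq> T"
      unfolding openin_mtopology by blast
    obtain A B where p: "p = (A, B)" by (cases p)
    have AB: "A \<in> copulas" "B \<in> copulas" using \<open>p \<in> T\<close> T by (auto simp: p P_sl_def)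
    \<comment> \<open>The perturbation moves each component by at most \<open>3 * a\<close>, and
      \<open>a <= r / 4\<close> keeps this below \<open>r\<close>.\<close>
    define a where "a = min (1/2) (r / 4)"
    have a: "0 < a" "a < 1" "3 * a < r" using \<open>0 < r\<close> by (auto simp: a_def min_def)
    let ?A = "ordinal_sum a sum_MW A" and ?B = "ordinal_sum a sum_WM B"
    have "?A \<in> copulas" "?B \<in> copulas"
      using a AB by (auto intro: ordinal_sum_copula sum_MW sum_WM)
    moreover have "copula_dist A ?A < r" "copula_dist B ?B < r"
      using copula_dist_ordinal_sum[OF a(1,2) sum_MW AB(1)] copula_dist_ordinal_sum[OF a(1,2) sum_WM AB(2)]
        a(3) by (simp_all add: C.commute)
    ultimately have "(?A, ?B) \<in> mball p r" unfolding p ball using AB by blast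
    with r T have "(?A, ?B) \<in> P_sl" by blast
    then show False
      using perturbation_incomparable[OF a(1,2) AB] by (auto simp: P_sl_def sl_le_def not_le[symmetric])
  qed
  ultimately show ?thesis ..
qed

end
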